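(* Consider the synchronous machine system with state variables $x=(\delta,\omega,i_d,i_q)$, $$\begin{aligned}\dot\delta&=\omega-\omega^s,\\ J\dot\omega&=-D\omega-b\,i_q+T_m,\\ L\,\dot i_d&=-R\,i_d+L\omega i_q-R_LI\sin\delta,\\ L\,\dot i_q&=-R\,i_q-L\omega i_d+b\,\omega-R_LI\cos\delta,\end{aligned}$$ where $\delta=\theta^s-\theta$, $R=R_s+R_l+R_L$, and the mechanical torque input is set to zero, $T_m=0$. Let the input be the source current and the output be the load-bus voltage: $$u_1=I\begin{bmatrix}\sin(\theta^s-\theta)\\ \cos(\theta^s-\theta)\end{bmatrix}=\begin{bmatrix}I_d\\ I_q\end{bmatrix},\qquad y_1=R_L\left(\begin{bmatrix}i_d\\ i_q\end{bmatrix}+I\begin{bmatrix}\sin(\theta^s-\theta)\\ \cos(\theta^s-\theta)\end{bmatrix}\right)=\begin{bmatrix}V_d\\ V_q\end{bmatrix}.$$ Then the system is passive with respect to the input-output pair $(u_1,y_1)$.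
   Context: Here $\theta$ is the rotor angle, $\omega=\dot\theta$ the rotor angular velocity, $\theta^s=\omega^st$ the angle of an external current source with fixed angular velocity $\omega^s$ and constant $dq$-amplitude $I$, and $\delta=\theta^s-\theta$ the rotor angle deviation relative to the source. $i_d,i_q$ are the stator currents in the rotor-aligned $dq$-frame. The constants are the rotor inertia $J>0$, damping coefficient $D>0$, total stator-plus-line inductance $L>0$, stator, line and load resistances $R_s,R_l,R_L>0$, and $b=M_fi_f\sqrt{3/2}$ with $M_f$ the mutual inductance and $i_f$ the constant field current. Passivity: a system $\dot x=f(x,u)$, $y=g(x,u)$ with $x\in\mathbb{R}^n$, $u,y\in\mathbb{R}^m$ is passive about the equilibrium $(x^\star,u^\star,y^\star)=(0,0,0)$ if there exists a continuously differentiable storage function $V:\mathbb{R}^n\to\mathbb{R}_{\ge0}$ with $V(0)=0$ such that $\dot V(x)\le y^\top u$, where $\dot V$ is the derivative along trajectories. As a standing convention, it is assumed without loss of generality that the system has an equilibrium at which the output vanishes. *)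

theory Defs
  imports "HOL-Analysis.Analysis"
begin

text \<open>
  Passivity about the origin of the system \<open>x' = f x u\<close>, \<open>y = g x u\<close>.  The storage function \<open>V\<close>
  is continuously differentiable with gradient \<open>gradV\<close>; by the chain rule, the derivative of \<open>V\<close> along
  a trajectory that is in state \<open>x\<close> with input value \<open>u\<close> is \<open>gradV x \<bullet> f x u\<close>.
  That \<open>f 0 0 = 0\<close> and \<open>g 0 0 = 0\<close> is not part of the predicate.
\<close>

definition passive_system :: "(real^'n \<Rightarrow> real^'m \<Rightarrow> real^'n) \<Rightarrow> (real^'n \<Rightarrow> real^'m \<Rightarrow> real^'m) \<Rightarrow> bool"
  where "passive_system f g \<longleftrightarrow>
    (\<exists>(V :: real^'n \<Rightarrow> real) gradV.
       (\<forall>x. GDERIV V x :> gradV x) \<and> continuous_on UNIV gradV \<and>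
       (\<forall>x. 0 \<le> V x) \<and> V 0 = 0 \<and>
       (\<forall>x u. gradV x \<bullet> f x u \<le> g x u \<bullet> u))"

text \<open>
  The synchronous machine with state \<open>x = (\<delta>, \<omega>, i_d, i_q)\<close> (components 1 to 4), driven by a current
  source of amplitude \<open>I\<close>, solved for the derivatives.
\<close>

definition machine_field ::
    "real \<Rightarrow> real \<Rightarrow> real \<Rightarrow> real \<Rightarrow> real \<Rightarrow> real \<Rightarrow> real \<Rightarrow> real \<Rightarrow> real \<Rightarrow> real^4 \<Rightarrow> real^4"
  where "machine_field J D L R R\<^sub>L b \<omega>\<^sub>s T\<^sub>m I x =
    (let \<delta> = x $ 1; \<omega> = x $ 2; i\<^sub>d = x $ 3; i\<^sub>q = x $ 4 in
      vector [\<omega> - \<omega>\<^sub>s,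
              (- D * \<omega> - b * i\<^sub>q + T\<^sub>m) / J,
              (- R * i\<^sub>d + L * \<omega> * i\<^sub>q - R\<^sub>L * I * sin \<delta>) / L,
              (- R * i\<^sub>q - L * \<omega> * i\<^sub>d + b * \<omega> - R\<^sub>L * I * cos \<delta>) / L])"

definition source_current :: "real \<Rightarrow> real^4 \<Rightarrow> real^2"
  where "source_current I x = I *\<^sub>R vector [sin (x $ 1), cos (x $ 1)]"

definition load_voltage :: "real \<Rightarrow> real \<Rightarrow> real^4 \<Rightarrow> real^2"
  where "load_voltage R\<^sub>L I x =
    R\<^sub>L *\<^sub>R (vector [x $ 3, x $ 4] + I *\<^sub>R vector [sin (x $ 1), cos (x $ 1)])"

text \<open>
  The same machine as an input-output system: the source current \<open>u = (I_d, I_q)\<close> is a free input,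
  in place of \<open>I sin \<delta>\<close> and \<open>I cos \<delta>\<close>.
\<close>

definition machine_io_field ::
    "real \<Rightarrow> real \<Rightarrow> real \<Rightarrow> real \<Rightarrow> real \<Rightarrow> real \<Rightarrow> real \<Rightarrow> real \<Rightarrow> real^4 \<Rightarrow> real^2 \<Rightarrow> real^4"
  where "machine_io_field J D L R R\<^sub>L b \<omega>\<^sub>s T\<^sub>m x u =
    (let \<omega> = x $ 2; i\<^sub>d = x $ 3; i\<^sub>q = x $ 4 in
      vector [\<omega> - \<omega>\<^sub>s,
              (- D * \<omega> - b * i\<^sub>q + T\<^sub>m) / J,
              (- R * i\<^sub>d + L * \<omega> * i\<^sub>q - R\<^sub>L * u $ 1) / L,
              (- R * i\<^sub>q - L * \<omega> * i\<^sub>d + b * \<omega> - R\<^sub>L * u $ 2) / L])"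

definition machine_io_output :: "real \<Rightarrow> real^4 \<Rightarrow> real^2 \<Rightarrow> real^2"
  where "machine_io_output R\<^sub>L x u = R\<^sub>L *\<^sub>R (vector [x $ 3, x $ 4] + u)"

end

(* The storage function is the kinetic plus magnetic energy V = (J \<omega>\<^sup>2 + L |i|\<^sup>2) / 2. Along trajectories
   the torque term - b \<omega> i_q cancels the back-EMF term b \<omega> i_q and the rotational terms L \<omega> i_q i_d cancel,
   which leaves V' = - D \<omega>\<^sup>2 - R |i|\<^sup>2 - R_L i \<bullet> u. Hence
   y \<bullet> u - V' = D \<omega>\<^sup>2 + (R_s + R_l) |i|\<^sup>2 + R_L |i + u|\<^sup>2 \<ge> 0. *)

theory Submission imports Defs
begin

lemma vector_4 [simp]:
  "(vector [x, y, z, w] :: 'a::zero^4) $ 1 = x"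
  "(vector [x, y, z, w] :: 'a::zero^4) $ 2 = y"
  "(vector [x, y, z, w] :: 'a::zero^4) $ 3 = z"
  "(vector [x, y, z, w] :: 'a::zero^4) $ 4 = w"
  unfolding vector_def by simp_all

lemma GDERIV_half_weighted_squares:
  fixes w :: "real^'n"
  shows "GDERIV (\<lambda>x. (\<Sum>i\<in>UNIV. w $ i * (x $ i)\<^sup>2) / 2) x :> (\<chi> i. w $ i * x $ i)"
  unfolding gderiv_def
  by (auto intro!: derivative_eq_intros bounded_linear_imp_has_derivative[OF bounded_linear_vec_nth]
      simp: inner_vec_def fun_eq_iff sum_divide_distrib algebra_simps)

text \<open>Half a weighted sum of squares is smooth and vanishes at the origin, and nonnegative
  weights make it a storage function; only the dissipation inequality is left to check. Zero weights
  are allowed, so a state may carry no energy.\<close>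

lemma passive_systemI_half_weighted_squares:
  fixes w :: "real^'n"
  assumes "\<And>i. 0 \<le> w $ i"
    and "\<And>x u. (\<chi> i. w $ i * x $ i) \<bullet> f x u \<le> g x u \<bullet> u"
  shows "passive_system f g"
  unfolding passive_system_def
proof (intro exI conjI)
  let ?V = "\<lambda>x::real^'n. (\<Sum>i\<in>UNIV. w $ i * (x $ i)\<^sup>2) / 2"
  show "\<forall>x. GDERIV ?V x :> (\<chi> i. w $ i * x $ i)"
    by (simp add: GDERIV_half_weighted_squares)
  show "continuous_on UNIV (\<lambda>x. \<chi> i. w $ i * x $ i)"
    by (intro continuous_intros)
  show "\<forall>x. 0 \<le> ?V x"
    using assms(1) by (simp add: sum_nonneg)
qed (use assms(2) in simp_all)

lemma passive_machine_io:
  assumes "J > 0" "D \<ge> 0" "L > 0" "0 \<le> R\<^sub>L" "R\<^sub>L \<le> R"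
  shows "passive_system (machine_io_field J D L R R\<^sub>L b \<omega>\<^sub>s 0) (machine_io_output R\<^sub>L)"
proof (rule passive_systemI_half_weighted_squares)
  \<comment> \<open>The angle stores no energy, hence weight 0. The weights \<open>J\<close> and
    \<open>L\<close> give kinetic and magnetic energy and cancel the denominators of the
    field.\<close>
  let ?w = "vector [0, J, L, L] :: real^4"
  show "0 \<le> ?w $ i" for i
    using assms exhaust_4[of i] by auto
  show "(\<chi> i. ?w $ i * x $ i) \<bullet> machine_io_field J D L R R\<^sub>L b \<omega>\<^sub>s 0 x u
      \<le> machine_io_output R\<^sub>L x u \<bullet> u" (is "?dV \<le> ?yu") for x :: "real^4" and u :: "real^2"
  proof -
    \<comment> \<open>Splitting \<open>R\<close> as \<open>(R - R\<^sub>L) + R\<^sub>L\<close>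
      completes the square: the cross term \<open>2 * R\<^sub>L * (i \<bullet> u)\<close>, half from
      the output and half from \<open>?dV\<close>, is absorbed into the load loss.\<close>
    have "?yu - ?dV = D * (x $ 2)\<^sup>2 + (R - R\<^sub>L) * ((x $ 3)\<^sup>2 + (x $ 4)\<^sup>2)
        + R\<^sub>L * ((x $ 3 + u $ 1)\<^sup>2 + (x $ 4 + u $ 2)\<^sup>2)"
      using assms(1,3)
      by (simp add: machine_io_field_def machine_io_output_def inner_vec_def sum_4 sum_2
          Let_def power2_eq_square field_simps)
    also have "\<dots> \<ge> 0"
      using assms by simp
    finally show ?thesis by simp
  qed
qed

theorem theorem1:
  fixes J D L R R\<^sub>s R\<^sub>l R\<^sub>L b M\<^sub>f i\<^sub>f \<omega>\<^sub>s T\<^sub>m I :: real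
  assumes "J > 0" and "D > 0" and "L > 0"
    and "R\<^sub>s > 0" and "R\<^sub>l > 0" and "R\<^sub>L > 0"
    and "R = R\<^sub>s + R\<^sub>l + R\<^sub>L"
    and "b = M\<^sub>f * i\<^sub>f * sqrt (3 / 2)"
    and "T\<^sub>m = 0"
  shows "(\<forall>x. machine_io_field J D L R R\<^sub>L b \<omega>\<^sub>s T\<^sub>m x (source_current I x)
               = machine_field J D L R R\<^sub>L b \<omega>\<^sub>s T\<^sub>m I x) \<and>
         (\<forall>x. machine_io_output R\<^sub>L x (source_current I x) = load_voltage R\<^sub>L I x) \<and>
         passive_system (machine_io_field J D L R R\<^sub>L b \<omega>\<^sub>s T\<^sub>m) (machine_io_output R\<^sub>L)"
proof (intro conjI allI)
  show "machine_io_field J D L R R\<^sub>L b \<omega>\<^sub>s T\<^sub>m x (source_current I x)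
      = machine_field J D L R R\<^sub>L b \<omega>\<^sub>s T\<^sub>m I x" for x
    by (simp add: machine_io_field_def machine_field_def source_current_def Let_def mult.assoc)
  show "machine_io_output R\<^sub>L x (source_current I x) = load_voltage R\<^sub>L I x" for x
    by (simp add: machine_io_output_def load_voltage_def source_current_def)
  \<comment> \<open>Here \<open>R - R\<^sub>L\<close> is the stator plus line resistance, which is
    positive.\<close>
  show "passive_system (machine_io_field J D L R R\<^sub>L b \<omega>\<^sub>s T\<^sub>m) (machine_io_output R\<^sub>L)"
    using passive_machine_io[of J D L R\<^sub>L R] assms by simp
qed

end
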